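(* Let $G$ be a finite tree, let $\mathcal{P}$ be the set of all paths in $G$ of length $\mathrm{diam}(G)$, and let $v \in V(G)$ be a starting vertex. Let $\ell = \min\{\mathrm{dist}(u,v) : u \in V(P),\ P \in \mathcal{P}\}$ be the distance from $v$ to the nearest vertex lying on some path of $\mathcal{P}$. Then $$f_d(G,v) = \mathrm{diam}(G)+\ell+1.$$
   Context: The length of a path is its number of edges, $\mathrm{dist}(u,v)$ is the length of a shortest path between $u$ and $v$, and $\mathrm{diam}(G)$ is the maximum distance between two vertices of $G$. Explorer-Director game on a connected graph $G$ with starting vertex $v$: a token is initially at $v$ (so $v$ counts as visited). On each turn the Explorer names a distance $d$ such that at least one vertex of $G$ is at distance exactly $d$ from the token's current position, and then the Director moves the token to a vertex of their choice at distance exactly $d$ from the current position. The Explorer wants to maximize, and the Director to minimize, the number of distinct vertices visited by the token; play continues until the Explorer can no longer force the token onto an unvisited vertex. $f_d(G,v)$ is the number of visited vertices at the end of the game under optimal play by both players; equivalently, it is the largest $k$ such that the Explorer has a (possibly adaptive) strategy guaranteeing, against every play of the Director, that at least $k$ distinct vertices (including $v$) are visited after finitely many turns. *)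

theory Defs
  imports "Graph_Theory.Digraph_Component" "Graph_Theory.Vertex_Walk"
begin

text \<open>
  A finite simple graph is a term of type \<^typ>\<open>('a,'b) pre_digraph\<close> satisfying \<^locale>\<open>graph\<close>:
  every undirected edge is a pair of opposite arcs. Under this encoding
  \<^const>\<open>pre_digraph.cycle\<close> also holds of the closed walk running through an edge and back, so
  \<^const>\<open>tree\<close> fails for every graph with an edge; cycles of an undirected graph are those of
  length at least 3.
\<close>

locale finite_tree = graph G for G :: "('a,'b) pre_digraph" (structure) +
  assumes conn: "connected G"
    and acyc: "\<not> (\<exists>p. cycle p \<and> 3 \<le> length p)"

text \<open>
  A path is given by its list of vertices (\<^const>\<open>vpath\<close>), and \<^const>\<open>vwalk_length\<close> counts its
  edges. For vertices in different components the value of \<open>graph_dist\<close> is irrelevant.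
\<close>

definition graph_dist :: "('a,'b) pre_digraph \<Rightarrow> 'a \<Rightarrow> 'a \<Rightarrow> nat" where
  "graph_dist G u v =
    (LEAST n. \<exists>p. vpath p G \<and> hd p = u \<and> last p = v \<and> vwalk_length p = n)"

definition diam :: "('a,'b) pre_digraph \<Rightarrow> nat" where
  "diam G = Max {graph_dist G u v | u v. u \<in> verts G \<and> v \<in> verts G}"

definition diam_paths :: "('a,'b) pre_digraph \<Rightarrow> 'a vwalk set" where
  "diam_paths G = {p. vpath p G \<and> vwalk_length p = diam G}"

text \<open>
  An Explorer strategy maps the history of the game, the nonempty list of all token positions so
  far (the last entry being the current one), to the distance named next. It must always name a
  distance at which there is a vertex; by this rule the distance 0 is always permitted, so that
  the game can be continued forever.
\<close>

definition explorer_strategy :: "('a,'b) pre_digraph \<Rightarrow> ('a list \<Rightarrow> nat) \<Rightarrow> bool" where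
  "explorer_strategy G \<sigma> \<longleftrightarrow>
    (\<forall>h. h \<noteq> [] \<and> set h \<subseteq> verts G \<longrightarrow> (\<exists>w \<in> verts G. graph_dist G (last h) w = \<sigma> h))"

text \<open>
  The infinite sequences of token positions, with \<open>x n\<close> the position after \<open>n\<close> turns, which
  the Director can produce against \<open>\<sigma>\<close>.
\<close>

definition play_against ::
    "('a,'b) pre_digraph \<Rightarrow> 'a \<Rightarrow> ('a list \<Rightarrow> nat) \<Rightarrow> (nat \<Rightarrow> 'a) \<Rightarrow> bool" where
  "play_against G v \<sigma> x \<longleftrightarrow>
    x 0 = v \<and>
    (\<forall>n. x (Suc n) \<in> verts G \<and> graph_dist G (x n) (x (Suc n)) = \<sigma> (map x [0..<Suc n]))"

definition explorer_guarantees :: "('a,'b) pre_digraph \<Rightarrow> 'a \<Rightarrow> nat \<Rightarrow> bool" where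
  "explorer_guarantees G v k \<longleftrightarrow>
    (\<exists>\<sigma>. explorer_strategy G \<sigma> \<and>
      (\<forall>x. play_against G v \<sigma> x \<longrightarrow> (\<exists>n. k \<le> card (x ` {0..n}))))"

definition f_d :: "('a,'b) pre_digraph \<Rightarrow> 'a \<Rightarrow> nat" where
  "f_d G v = Max {k. explorer_guarantees G v k}"

end

theory Submission
  imports Defs
begin

text \<open>
  Call a set of vertices closed if from each of its members every distance realised in the tree
  is realised inside the set. The Director can stay in a closed set forever, and a diametral path
  together with a shortest path from \<open>v\<close> to it is closed; this gives the upper bound.

  For the lower bound let the height of a vertex be its distance from the nearest diametral path.
  A closed set containing a vertex of height \<open>t\<close> has at least \<open>diam G + t + 1\<close> elements. The
  Explorer first names small distances only, which keeps the token at positive height, until for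
  each \<open>i\<close> from 1 to \<open>l\<close> at least \<open>l - i + 1\<close> vertices of height at least \<open>i\<close> are visited. After
  that, as long as the visited vertices contain no closed set a new vertex can be forced; and if
  they contain one with maximal height \<open>t\<close>, there are another \<open>l - t\<close> visited vertices above it.
\<close>

subsection \<open>Walks and distances\<close>

lemma length_vwalk_to_vpath: "length (vwalk_to_vpath p) \<le> length p"
proof (induction p rule: vwalk_to_vpath_induct3)
  case (in_set x xs)
  then show ?case using length_dropWhile_le[of "\<lambda>y. y \<noteq> x" xs] by simp
qed auto

lemma vwalk_nthI:
  assumes "vwalk p G" "Suc i < length p"
  shows "(p ! i, p ! Suc i) \<in> arcs_ends G"
  using assms
proof (induction p arbitrary: i rule: vwalk_induct)
  case (Cons u v es)
  then show ?case by (cases i) auto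
qed auto

lemma vwalk_rev:
  assumes "sym_digraph G" "vwalk p G"
  shows "vwalk (rev p) G"
  using assms sym_digraph.graph_symmetric[OF assms(1)]
  by (fastforce simp: vwalk_def set_vwalk_arcs_rev)

text \<open>Acyclicity speaks of arc walks, paths are vertex lists; this carries a closed vertex
  walk over to \<open>cycle\<close>.\<close>

lemma (in wf_digraph) vwalk_imp_ex_awalk:
  assumes "vwalk p G"
  shows "\<exists>es. awalk (hd p) es (last p) \<and> awalk_verts (hd p) es = p"
  using assms
proof (induction p rule: vwalk_induct)
  case (Base u)
  then show ?case by (intro exI[of _ "[]"]) (auto simp: awalk_Nil_iff)
next
  case (Cons u v es)
  then obtain as where as: "awalk v as (last (v # es))" "awalk_verts v as = v # es" by auto
  obtain e where "e \<in> arcs G" "tail G e = u" "head G e = v"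
    using Cons(1) by (auto simp: arcs_ends_def arc_to_ends_def)
  then show ?case using as by (intro exI[of _ "e # as"]) (auto simp: awalk_Cons_iff)
qed

text \<open>In use, \<open>f\<close> is the distance from a fixed vertex: one vertex at each of
  \<open>n\<close> distances gives \<open>n\<close> vertices.\<close>

lemma le_card_if_hits_lessThan:
  fixes f :: "'c \<Rightarrow> nat"
  assumes "finite A" "\<And>i. i < n \<Longrightarrow> \<exists>y\<in>A. f y = i"
  shows "n \<le> card A"
proof -
  have "{..<n} \<subseteq> f ` A" using assms(2) by force
  then show ?thesis using surj_card_le[OF assms(1)] by fastforce
qed

context finite_tree
begin

abbreviation \<delta> :: "'a \<Rightarrow> 'a \<Rightarrow> nat" where "\<delta> \<equiv> graph_dist G"

lemma sym_digraph_G: "sym_digraph G" by unfold_locales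

lemma arcs_ends_irrefl: "(u, w) \<in> arcs_ends G \<Longrightarrow> u \<noteq> w"
  using no_loops by (auto simp: arcs_ends_def arc_to_ends_def)

lemma ex_shortest_path:
  assumes "u \<in> verts G" "w \<in> verts G"
  obtains p where "vpath p G" "hd p = u" "last p = w" "length p = Suc (\<delta> u w)"
proof -
  have "strongly_connected G"
    using conn symmetric_connected_imp_strongly_connected sym_arcs by blast
  then have "u \<rightarrow>\<^sup>* w" using assms by auto
  then obtain p where "vpath p G" "hd p = u" "last p = w" by (auto simp: reachable_vpath_conv)
  then have "\<exists>n p. vpath p G \<and> hd p = u \<and> last p = w \<and> vwalk_length p = n" by auto
  from LeastI_ex[OF this] obtain q
    where q: "vpath q G" "hd q = u" "last q = w" "vwalk_length q = \<delta> u w"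
    unfolding graph_dist_def by auto
  moreover have "q \<noteq> []" using q(1) by auto
  ultimately show ?thesis using that[of q] by (cases q) auto
qed

lemma dist_le_vwalk:
  assumes "vwalk p G"
  shows "\<delta> (hd p) (last p) \<le> length p - 1"
proof -
  let ?q = "vwalk_to_vpath p"
  have "vpath ?q G \<and> hd ?q = hd p \<and> last ?q = last p \<and> vwalk_length ?q = vwalk_length ?q"
    using vwalk_to_vpath_vpath[OF assms] vwalk_to_vpath_hd vwalk_to_vpath_last by blast
  then have "\<delta> (hd p) (last p) \<le> vwalk_length ?q"
    unfolding graph_dist_def by (rule Least_le[OF exI])
  then show ?thesis using length_vwalk_to_vpath[of p] by simp
qed

lemma dist_self [simp]: "u \<in> verts G \<Longrightarrow> \<delta> u u = 0"
  using dist_le_vwalk[of "[u]"] by (auto simp: vwalk_def)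

lemma dist_eq_0D:
  assumes "\<delta> u w = 0" "u \<in> verts G" "w \<in> verts G"
  shows "u = w"
proof -
  from ex_shortest_path[OF assms(2,3)] obtain p
    where "hd p = u" "last p = w" "length p = Suc (\<delta> u w)" .
  then show ?thesis using assms(1) by (auto simp: length_Suc_conv)
qed

lemma dist_commute:
  assumes "u \<in> verts G" "w \<in> verts G"
  shows "\<delta> u w = \<delta> w u"
proof -
  have "\<delta> w u \<le> \<delta> u w" if uw: "u \<in> verts G" "w \<in> verts G" for u w
  proof -
    from ex_shortest_path[OF uw] obtain p
      where "vpath p G" "hd p = u" "last p = w" "length p = Suc (\<delta> u w)" .
    then show ?thesis
      using dist_le_vwalk[OF vwalk_rev[OF sym_digraph_G, of p]]
      by (auto simp: hd_rev last_rev)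
  qed
  then show ?thesis using assms by (simp add: antisym)
qed

lemma dist_triangle:
  assumes "u \<in> verts G" "w \<in> verts G" "z \<in> verts G"
  shows "\<delta> u z \<le> \<delta> u w + \<delta> w z"
proof -
  from ex_shortest_path[OF assms(1,2)] obtain p
    where p: "vpath p G" "hd p = u" "last p = w" "length p = Suc (\<delta> u w)" .
  from ex_shortest_path[OF assms(2,3)] obtain q
    where q: "vpath q G" "hd q = w" "last q = z" "length q = Suc (\<delta> w z)" .
  have "p \<noteq> []" "q \<noteq> []" using p(4) q(4) by auto
  then have j: "joinable p q" using p(3) q(2) by (simp add: joinable_def)
  then have "vwalk (vwalk_join p q) G" using p(1) q(1) by (intro vwalk_joinI_vwalk) auto
  from dist_le_vwalk[OF this] show ?thesis
    using vwalk_join_vwalk_length[OF j] vwalk_join_hd[OF j] vwalk_join_last[OF j] p(2-4) q(2-4) by simp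
qed

lemma dist_adj:
  assumes "(u, w) \<in> arcs_ends G"
  shows "\<delta> u w = 1"
proof -
  have uw: "u \<in> verts G" "w \<in> verts G" using assms adj_in_verts by auto
  have "vwalk [u, w] G" using assms uw by (auto simp: vwalk_def)
  then have "\<delta> u w \<le> 1" using dist_le_vwalk[of "[u, w]"] by simp
  moreover have "\<delta> u w \<noteq> 0" using dist_eq_0D[OF _ uw] arcs_ends_irrefl[OF assms] by blast
  ultimately show ?thesis by simp
qed

text \<open>Otherwise the walk, shortened to a path and closed up through \<open>u\<close>, would be
  a cycle.\<close>

lemma no_bypass:
  assumes "(u, a) \<in> arcs_ends G" "(u, b) \<in> arcs_ends G"
    and "vwalk q G" "hd q = a" "last q = b" "u \<notin> set q"
  shows "a = b"
proof (rule ccontr)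
  assume "a \<noteq> b"
  define r where "r = vwalk_to_vpath q"
  have r: "vpath r G" "hd r = a" "last r = b" "u \<notin> set r"
    using assms vwalk_to_vpath_subset[of u q]
    by (auto simp: r_def vwalk_to_vpath_vpath vwalk_to_vpath_hd vwalk_to_vpath_last)
  then have rne: "r \<noteq> []" by auto
  \<comment> \<open>So the cycle has at least 3 arcs and is not an edge run back and forth, which
    \<open>acyc\<close> permits.\<close>
  have len: "length r \<ge> 2"
    using r rne \<open>a \<noteq> b\<close> by (cases r; cases "tl r") auto
  have uV: "u \<in> verts G" using assms adj_in_verts by auto
  have "vwalk (r @ [u]) G"
    using r rne uV graph_symmetric[OF assms(2)] by (auto simp: vwalk_def vpath_def set_vwalk_arcs_snoc)
  then have "vwalk (u # r @ [u]) G"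
    using assms(1) r rne by (intro vwalk_wf_digraph_consI) auto
  then obtain es where es: "awalk u es u" "awalk_verts u es = u # r @ [u]"
    using vwalk_imp_ex_awalk[of "u # r @ [u]"] by auto
  have "length es = length r + 1" using es(2) length_awalk_verts[of u es] by simp
  moreover have "cycle es"
    unfolding cycle_def using es r \<open>length es = length r + 1\<close> by (intro exI[of _ u]) auto
  ultimately show False using acyc len by force
qed

text \<open>Shortest paths from \<open>a\<close> and \<open>b\<close> to \<open>z\<close> avoid
  \<open>u\<close>, so they join to a walk bypassing \<open>u\<close>. Equality is allowed in the
  hypotheses in order to exclude adjacent vertices equidistant from \<open>z\<close> later.\<close>

lemma closer_neighbour_unique:
  assumes "(u, a) \<in> arcs_ends G" "(u, b) \<in> arcs_ends G" "z \<in> verts G"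
    and "\<delta> a z \<le> \<delta> u z" "\<delta> b z \<le> \<delta> u z"
  shows "a = b"
proof -
  have *: "\<exists>p. vwalk p G \<and> hd p = c \<and> last p = z \<and> u \<notin> set p"
    if c: "(u, c) \<in> arcs_ends G" "\<delta> c z \<le> \<delta> u z" for c
  proof -
    have "c \<in> verts G" using c adj_in_verts by auto
    from ex_shortest_path[OF this assms(3)] obtain p
      where p: "vpath p G" "hd p = c" "last p = z" "length p = Suc (\<delta> c z)" .
    \<comment> \<open>A shortest path from \<open>c\<close> through \<open>u\<close> would make
      \<open>c\<close> strictly farther from \<open>z\<close> than \<open>u\<close>.\<close>
    have "u \<notin> set p"
    proof
      assume "u \<in> set p"
      then obtain p1 p2 where pe: "p = p1 @ u # p2" by (meson split_list)
      then have "p1 \<noteq> []" using p(2) arcs_ends_irrefl[OF c(1)] by auto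
      have "vwalk (u # p2) G" using p(1) pe by (auto intro: vwalkI_append_r)
      then have "\<delta> u z \<le> length p2"
        using dist_le_vwalk[of "u # p2"] p(3) pe by simp
      moreover have "length p = length p1 + 1 + length p2" using pe by simp
      moreover have "0 < length p1" using \<open>p1 \<noteq> []\<close> by simp
      ultimately show False using p(4) c(2) by linarith
    qed
    then show ?thesis using p by auto
  qed
  obtain p where p: "vwalk p G" "hd p = a" "last p = z" "u \<notin> set p"
    using *[OF assms(1,4)] by blast
  obtain q where q: "vwalk q G" "hd q = b" "last q = z" "u \<notin> set q"
    using *[OF assms(2,5)] by blast
  have ne: "p \<noteq> []" "q \<noteq> []" using p q by auto
  then have j: "joinable p (rev q)" using p(3) q(3) by (simp add: joinable_def hd_rev)
  have "vwalk (vwalk_join p (rev q)) G"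
    using p(1) vwalk_rev[OF sym_digraph_G q(1)] j by (rule vwalk_joinI_vwalk)
  moreover have "u \<notin> set (vwalk_join p (rev q))"
    using p q by (auto simp: vwalk_join_def dest: list.set_sel(2)[rotated])
  ultimately show ?thesis
    using no_bypass[OF assms(1,2)] j p q ne by (simp add: vwalk_join_hd vwalk_join_last last_rev)
qed

text \<open>The predecessor on the path is the only neighbour not farther from the start, so the
  next vertex is farther by one. The induction looks back two vertices.\<close>

lemma dist_nth_vpath:
  assumes "vpath p G" "i \<le> j" "j < length p"
  shows "\<delta> (p ! i) (p ! j) = j - i"
proof -
  have V: "p ! k \<in> verts G" if "k < length p" for k
    using assms(1) that by (meson nth_mem vpathE vwalk_verts_in_verts)
  have adj: "(p ! k, p ! Suc k) \<in> arcs_ends G" if "Suc k < length p" for k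
    using assms(1) that vwalk_nthI by auto
  have "i + m < length p \<Longrightarrow> \<delta> (p ! i) (p ! (i + m)) = m" for m
  proof (induction m rule: less_induct)
    case (less m)
    consider "m = 0" | "m = 1" | k where "m = Suc (Suc k)" by (metis One_nat_def not0_implies_Suc)
    then show ?case
    proof cases
      case 1 then show ?thesis using V less.prems by simp
    next
      case 2 then show ?thesis using adj[of i] dist_adj less.prems by simp
    next
      case (3 k)
      let ?z = "p ! i" and ?a = "p ! (i + k)" and ?u = "p ! (i + Suc k)" and ?b = "p ! (i + m)"
      have in_V: "?z \<in> verts G" "?a \<in> verts G" "?u \<in> verts G" "?b \<in> verts G"
        using V less.prems 3 by auto
      have au: "(?a, ?u) \<in> arcs_ends G" and ub: "(?u, ?b) \<in> arcs_ends G"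
        using adj[of "i + k"] adj[of "i + Suc k"] less.prems 3 by auto
      have zd: "\<delta> ?z ?a = k" "\<delta> ?z ?u = Suc k"
        using less.IH[of k] less.IH[of "Suc k"] less.prems 3 by simp_all
      have "?a \<noteq> ?b" using assms(1) less.prems 3 by (auto simp: vpath_def nth_eq_iff_index_eq)
      then have "\<not> \<delta> ?b ?z \<le> \<delta> ?u ?z"
        using closer_neighbour_unique[OF graph_symmetric[OF au] ub, of ?z] in_V zd
        by (auto simp: dist_commute)
      moreover have "\<delta> ?z ?b \<le> Suc k + 1"
        using dist_triangle[of ?z ?u ?b] in_V zd dist_adj[OF ub] by simp
      ultimately show ?thesis using in_V zd 3 by (simp add: dist_commute)
    qed
  qed
  from this[of "j - i"] show ?thesis using assms by simp
qed

lemma dist_vpath: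
  assumes "vpath p G"
  shows "\<delta> (hd p) (last p) = length p - 1"
proof -
  have "p \<noteq> []" using assms by auto
  then show ?thesis
    using dist_nth_vpath[OF assms, of 0 "length p - 1"] by (simp add: hd_conv_nth last_conv_nth)
qed

text \<open>The neighbour of \<open>a\<close> on a shortest path to \<open>z\<close> is strictly
  closer; under equality \<open>b\<close> would have to be that neighbour.\<close>

lemma dist_adj_neq:
  assumes "(a, b) \<in> arcs_ends G" "z \<in> verts G"
  shows "\<delta> a z \<noteq> \<delta> b z"
proof
  assume eq: "\<delta> a z = \<delta> b z"
  have V: "a \<in> verts G" "b \<in> verts G" using assms adj_in_verts by auto
  have "a \<noteq> z"
  proof
    assume "a = z"
    then have "\<delta> b z = 0" using eq V by simp
    then show False using dist_eq_0D[of b z] V assms arcs_ends_irrefl[OF assms(1)] \<open>a = z\<close> by simp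
  qed
  from ex_shortest_path[OF V(1) assms(2)] obtain p
    where p: "vpath p G" "hd p = a" "last p = z" "length p = Suc (\<delta> a z)" .
  obtain c r where pe: "p = a # c # r"
    using p(2-4) \<open>a \<noteq> z\<close> by (cases p; cases "tl p") auto
  then have ac: "(a, c) \<in> arcs_ends G" and w: "vwalk (c # r) G"
    using p(1) by (auto simp: vpath_def vwalk_def)
  have "\<delta> c z \<le> length r" using dist_le_vwalk[OF w] p(3) pe by simp
  then have "\<delta> c z < \<delta> a z" using p(4) pe by simp
  moreover have "b = c"
    using closer_neighbour_unique[OF assms(1) ac assms(2)] eq calculation by simp
  ultimately show False using eq by simp
qed

subsection \<open>Medians and the four-point condition\<close>

lemma nth_vpath_in_verts: "vpath p G \<Longrightarrow> i < length p \<Longrightarrow> p ! i \<in> verts G"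
  by (meson nth_mem vpathE vwalk_verts_in_verts)

text \<open>The first step away from the nearest vertex raises the distance by
  \<open>dist_adj_neq\<close>; from then on the predecessor is the unique closer neighbour, so every
  step raises it.\<close>

lemma dist_beyond_nearest:
  assumes p: "vpath p G" and w: "w \<in> verts G" and ij: "i \<le> j" "j < length p"
    and min: "\<And>j. j < length p \<Longrightarrow> \<delta> (p ! i) w \<le> \<delta> (p ! j) w"
  shows "\<delta> (p ! j) w = \<delta> (p ! i) w + (j - i)"
proof -
  note V = nth_vpath_in_verts[OF p]
  have adj: "(p ! k, p ! Suc k) \<in> arcs_ends G" if "Suc k < length p" for k
    using p that vwalk_nthI by auto
  have step: "\<delta> (p ! Suc k) w \<le> Suc (\<delta> (p ! k) w)" if "Suc k < length p" for k
    using dist_triangle[of "p ! Suc k" "p ! k" w] dist_adj[OF graph_symmetric[OF adj[OF that]]]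
      V that w by simp
  have "i + m < length p \<Longrightarrow> \<delta> (p ! (i + m)) w = \<delta> (p ! i) w + m" for m
  proof (induction m rule: less_induct)
    case (less m)
    consider "m = 0" | "m = 1" | k where "m = Suc (Suc k)" by (metis One_nat_def not0_implies_Suc)
    then show ?case
    proof cases
      case 2
      then show ?thesis
        using min[of "Suc i"] step[of i] dist_adj_neq[OF adj w, of i] less.prems by simp
    next
      case (3 k)
      have a: "(p ! Suc (i + k), p ! (i + k)) \<in> arcs_ends G"
        using adj[of "i + k"] graph_symmetric less.prems 3 by simp
      have b: "(p ! Suc (i + k), p ! Suc (Suc (i + k))) \<in> arcs_ends G"
        using adj[of "Suc (i + k)"] less.prems 3 by simp
      have "p ! (i + k) \<noteq> p ! Suc (Suc (i + k))"
        using p less.prems 3 by (auto simp: vpath_def nth_eq_iff_index_eq)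
      moreover have "\<delta> (p ! (i + k)) w = \<delta> (p ! i) w + k"
        "\<delta> (p ! Suc (i + k)) w = \<delta> (p ! i) w + Suc k"
        using less.IH[of k] less.IH[of "Suc k"] less.prems 3 by auto
      ultimately show ?thesis
        using closer_neighbour_unique[OF a b w] step[of "Suc (i + k)"] less.prems 3 by fastforce
    qed simp
  qed
  from this[of "j - i"] show ?thesis using ij by simp
qed

text \<open>The gate is the vertex nearest to \<open>w\<close>; the previous lemma is applied to the
  path and to its reversal. With truncated subtraction, \<open>(i - j) + (j - i)\<close> is the
  absolute difference.\<close>

lemma ex_gate:
  assumes p: "vpath p G" and w: "w \<in> verts G"
  shows "\<exists>i<length p. \<forall>j<length p. \<delta> (p ! j) w = \<delta> (p ! i) w + (i - j) + (j - i)"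
proof -
  have "p \<noteq> []" using p by auto
  then obtain i where i: "i < length p" and min: "\<And>j. j < length p \<Longrightarrow> \<delta> (p ! i) w \<le> \<delta> (p ! j) w"
    using arg_min_if_finite[of "{..<length p}" "\<lambda>i. \<delta> (p ! i) w"] by (metis finite_lessThan
        length_greater_0_conv lessThan_empty_iff lessThan_iff not_le gr_implies_not0)
  have "\<delta> (p ! j) w = \<delta> (p ! i) w + (i - j) + (j - i)" if j: "j < length p" for j
  proof (cases "i \<le> j")
    case True
    then show ?thesis using dist_beyond_nearest[OF p w True j min] by simp
  next
    case False
    have rp: "vpath (rev p) G" using p vwalk_rev[OF sym_digraph_G] by (auto simp: vpath_def)
    have "\<delta> (rev p ! (length p - 1 - j)) w
        = \<delta> (rev p ! (length p - 1 - i)) w + ((length p - 1 - j) - (length p - 1 - i))"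
      using False i j min by (intro dist_beyond_nearest[OF rp w]) (auto simp: rev_nth)
    then show ?thesis using False i j by (simp add: rev_nth)
  qed
  then show ?thesis using i by blast
qed

text \<open>The median is the gate of \<open>w\<close> on a shortest path from \<open>x\<close> to
  \<open>y\<close>.\<close>

lemma ex_median:
  assumes "x \<in> verts G" "y \<in> verts G" "w \<in> verts G"
  obtains b where "b \<in> verts G" "\<delta> x y = \<delta> x b + \<delta> b y" "\<delta> x w = \<delta> x b + \<delta> b w"
    "\<delta> y w = \<delta> y b + \<delta> b w"
proof -
  from ex_shortest_path[OF assms(1,2)] obtain p
    where p: "vpath p G" "hd p = x" "last p = y" "length p = Suc (\<delta> x y)" .
  have ends: "p ! 0 = x" "p ! (\<delta> x y) = y"
    using p by (auto simp: hd_conv_nth last_conv_nth vpath_def vwalk_def)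
  obtain i where i: "i < length p"
    and *: "\<And>j. j < length p \<Longrightarrow> \<delta> (p ! j) w = \<delta> (p ! i) w + (i - j) + (j - i)"
    using ex_gate[OF p(1) assms(3)] by blast
  have b: "p ! i \<in> verts G" using nth_vpath_in_verts p(1) i by blast
  have "\<delta> x (p ! i) = i" "\<delta> (p ! i) y = \<delta> x y - i"
    using dist_nth_vpath[OF p(1), of 0 i] dist_nth_vpath[OF p(1), of i "\<delta> x y"] i ends p(4) by auto
  then show ?thesis
    using that[OF b] *[of 0] *[of "\<delta> x y"] ends i p(4) dist_commute[OF b assms(2)] by auto
qed

text \<open>The four-point condition of tree metrics. With the gates of \<open>w\<close> and
  \<open>x\<close> on a shortest path from \<open>p\<close> to \<open>q\<close>, the bound comes
  from the pairing whose two routes overlap between the gates.\<close>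

lemma four_point:
  assumes "p \<in> verts G" "q \<in> verts G" "w \<in> verts G" "x \<in> verts G"
  shows "\<delta> w x + \<delta> p q \<le> max (\<delta> p w + \<delta> q x) (\<delta> p x + \<delta> q w)"
proof -
  from ex_shortest_path[OF assms(1,2)] obtain r
    where r: "vpath r G" "hd r = p" "last r = q" "length r = Suc (\<delta> p q)" .
  have ends: "r ! 0 = p" "r ! (\<delta> p q) = q"
    using r by (auto simp: hd_conv_nth last_conv_nth vpath_def vwalk_def)
  obtain i where i: "i < length r"
    and wi: "\<And>j. j < length r \<Longrightarrow> \<delta> (r ! j) w = \<delta> (r ! i) w + (i - j) + (j - i)"
    using ex_gate[OF r(1) assms(3)] by blast
  obtain k where k: "k < length r"
    and xk: "\<And>j. j < length r \<Longrightarrow> \<delta> (r ! j) x = \<delta> (r ! k) x + (k - j) + (j - k)"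
    using ex_gate[OF r(1) assms(4)] by blast
  note V = nth_vpath_in_verts[OF r(1) i] nth_vpath_in_verts[OF r(1) k]
  have "\<delta> w x \<le> \<delta> (r ! i) w + \<delta> (r ! i) x"
    using dist_triangle[of w "r ! i" x] V assms by (simp add: dist_commute)
  then show ?thesis
    using wi[of 0] wi[of "\<delta> p q"] xk[of 0] xk[of "\<delta> p q"] xk[OF i] ends i k r(4) by simp
qed

section \<open>Spheres, eccentricity and diameter\<close>

lemma ex_at_dist:
  assumes "u \<in> verts G" "z \<in> verts G" "n \<le> \<delta> u z"
  shows "\<exists>y\<in>verts G. \<delta> u y = n"
proof -
  from ex_shortest_path[OF assms(1,2)] obtain p
    where p: "vpath p G" "hd p = u" "last p = z" "length p = Suc (\<delta> u z)" .
  then have "p ! 0 = u" by (auto simp: hd_conv_nth vpath_def vwalk_def)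
  then show ?thesis
    using dist_nth_vpath[OF p(1), of 0 n] nth_vpath_in_verts[OF p(1), of n] assms p by auto
qed

lemma finite_dists: "finite {\<delta> u w | u w. u \<in> verts G \<and> w \<in> verts G}"
proof -
  have "{\<delta> u w | u w. u \<in> verts G \<and> w \<in> verts G} = (\<lambda>(u, w). \<delta> u w) ` (verts G \<times> verts G)"
    by auto
  then show ?thesis by simp
qed

lemma dist_le_diam: "u \<in> verts G \<Longrightarrow> w \<in> verts G \<Longrightarrow> \<delta> u w \<le> diam G"
  unfolding diam_def using finite_dists by (intro Max_ge) auto

lemma verts_nonempty: "verts G \<noteq> {}"
  using conn by (auto simp: connected_def strongly_connected_def mk_symmetric_def)

lemma ex_diam: "\<exists>p\<in>verts G. \<exists>q\<in>verts G. \<delta> p q = diam G"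
proof -
  have "{\<delta> u w | u w. u \<in> verts G \<and> w \<in> verts G} \<noteq> {}" using verts_nonempty by auto
  from Max_in[OF finite_dists this] show ?thesis unfolding diam_def by fastforce
qed

text \<open>In the four-point condition each alternative contains a distance from \<open>z\<close>
  to \<open>p\<close> or \<open>q\<close>; it is at most \<open>diam G\<close> and cancels against
  \<open>\<delta> p q\<close>.\<close>

lemma diam_end_eccentric:
  assumes "p \<in> verts G" "q \<in> verts G" "\<delta> p q = diam G" "u \<in> verts G" "z \<in> verts G"
  shows "\<delta> u z \<le> max (\<delta> u p) (\<delta> u q)"
  using four_point[of p q u z] dist_le_diam[of p z] dist_le_diam[of q z] assms
  by (auto simp: dist_commute max_def split: if_splits)

text \<open>For a diametral pair \<open>p\<close>, \<open>q\<close>, the distances from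
  \<open>w\<close> to both are at most \<open>\<delta> w x\<close>; cancelling in the four-point
  condition puts \<open>p\<close> or \<open>q\<close> at distance \<open>diam G\<close> from
  \<open>x\<close>.\<close>

lemma farthest_is_diam_end:
  assumes "w \<in> verts G" "x \<in> verts G" "\<And>z. z \<in> verts G \<Longrightarrow> \<delta> w z \<le> \<delta> w x"
  shows "\<exists>y\<in>verts G. \<delta> x y = diam G"
proof -
  obtain p q where pq: "p \<in> verts G" "q \<in> verts G" "\<delta> p q = diam G" using ex_diam by blast
  have "diam G \<le> max (\<delta> x p) (\<delta> x q)"
    using four_point[OF pq(1,2) assms(1,2)] assms(3)[OF pq(1)] assms(3)[OF pq(2)] pq
      dist_commute[OF pq(1) assms(1)] dist_commute[OF pq(2) assms(1)]
      dist_commute[OF pq(1) assms(2)] dist_commute[OF pq(2) assms(2)]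
    by linarith
  then show ?thesis
    using dist_le_diam[of x p] dist_le_diam[of x q] assms pq by (metis antisym le_max_iff_disj)
qed

subsection \<open>Diametral paths\<close>

definition height :: "'a \<Rightarrow> nat" where
  "height w = Min {\<delta> u w | u P. P \<in> diam_paths G \<and> u \<in> set P}"

lemma diam_pathsD: "P \<in> diam_paths G \<Longrightarrow> u \<in> set P \<Longrightarrow> u \<in> verts G"
  by (auto simp: diam_paths_def vpath_def vwalk_def)

lemma finite_height: "finite {\<delta> u w | u P. P \<in> diam_paths G \<and> u \<in> set P}"
  by (rule finite_subset[of _ "(\<lambda>u. \<delta> u w) ` verts G"]) (auto dest: diam_pathsD)

lemma height_le:
  assumes "P \<in> diam_paths G" "u \<in> set P"
  shows "height w \<le> \<delta> u w"
  unfolding height_def using finite_height assms by (intro Min_le) auto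

lemma in_diam_pathsI:
  assumes "vpath P G" "length P = Suc (diam G)"
  shows "P \<in> diam_paths G"
  using assms by (simp add: diam_paths_def)

lemma ex_height:
  obtains u P where "P \<in> diam_paths G" "u \<in> set P" "height w = \<delta> u w"
proof -
  obtain p q where pq: "p \<in> verts G" "q \<in> verts G" "\<delta> p q = diam G" using ex_diam by blast
  from ex_shortest_path[OF pq(1,2)] obtain P
    where P: "vpath P G" "hd P = p" "last P = q" "length P = Suc (\<delta> p q)" .
  moreover have "P \<noteq> []" using P(4) by auto
  ultimately have "P \<in> diam_paths G" "hd P \<in> set P" using pq in_diam_pathsI by auto
  then have "{\<delta> u w | u P. P \<in> diam_paths G \<and> u \<in> set P} \<noteq> {}" by blast
  from Min_in[OF finite_height this] show ?thesis using that unfolding height_def by auto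
qed

lemma height_triangle:
  assumes "u \<in> verts G" "w \<in> verts G"
  shows "height u \<le> height w + \<delta> u w"
proof -
  obtain t P where t: "P \<in> diam_paths G" "t \<in> set P" "height w = \<delta> t w" using ex_height .
  then show ?thesis
    using height_le[OF t(1,2), of u] dist_triangle[of t w u] diam_pathsD assms
    by (auto simp: dist_commute)
qed

text \<open>The gate of \<open>b\<close> on a shortest path from \<open>x\<close> to
  \<open>y\<close> is \<open>b\<close> itself, so \<open>b\<close> lies on a diametral path.\<close>

lemma height_le_between:
  assumes "x \<in> verts G" "y \<in> verts G" "b \<in> verts G" "\<delta> x y = diam G" "\<delta> x y = \<delta> x b + \<delta> b y"
  shows "height w \<le> \<delta> b w"
proof -
  from ex_shortest_path[OF assms(1,2)] obtain p
    where p: "vpath p G" "hd p = x" "last p = y" "length p = Suc (\<delta> x y)" .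
  have ends: "p ! 0 = x" "p ! (\<delta> x y) = y"
    using p by (auto simp: hd_conv_nth last_conv_nth vpath_def vwalk_def)
  obtain i where i: "i < length p"
    and *: "\<And>j. j < length p \<Longrightarrow> \<delta> (p ! j) b = \<delta> (p ! i) b + (i - j) + (j - i)"
    using ex_gate[OF p(1) assms(3)] by blast
  have "\<delta> (p ! i) b = 0"
    using *[of 0] *[of "\<delta> x y"] ends p(4) i assms dist_commute[of b y] by simp
  then have "b = p ! i" using dist_eq_0D nth_vpath_in_verts[OF p(1) i] assms(3) by auto
  then show ?thesis
    using height_le[of p b w] in_diam_pathsI[OF p(1)] p(4) i assms(4) by auto
qed

text \<open>
  The sets inside which the Director can keep the token forever.
\<close>

definition dist_closed :: "'a set \<Rightarrow> bool" where
  "dist_closed W \<longleftrightarrow> W \<subseteq> verts G \<and> (\<forall>u\<in>W. \<forall>z\<in>verts G. \<exists>w\<in>W. \<delta> u w = \<delta> u z)"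

text \<open>
  Let \<open>x\<close> be farthest from \<open>w\<close>, let \<open>y\<close> be diametral to \<open>x\<close>, and let \<open>b\<close> be the median of
  \<open>x\<close>, \<open>y\<close>, \<open>w\<close>. The balls around \<open>x\<close>, \<open>y\<close>, \<open>w\<close> that reach to \<open>b\<close> are disjoint, \<open>b\<close> being
  assigned to the ball of \<open>x\<close>, and \<open>W\<close> meets every sphere that fills them.
\<close>

lemma card_dist_closed:
  assumes W: "dist_closed W" and w: "w \<in> W"
  shows "diam G + height w + 1 \<le> card W"
proof -
  have WV: "W \<subseteq> verts G" and cl: "\<And>u z. u \<in> W \<Longrightarrow> z \<in> verts G \<Longrightarrow> \<exists>w\<in>W. \<delta> u w = \<delta> u z"
    using W by (auto simp: dist_closed_def)
  have "finite W" using WV finite_verts finite_subset by blast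
  have "Max (\<delta> w ` verts G) \<in> \<delta> w ` verts G" using verts_nonempty by (intro Max_in) auto
  then obtain x0 where "x0 \<in> verts G" "\<delta> w x0 = Max (\<delta> w ` verts G)" by auto
  \<comment> \<open>Closedness replaces the farthest vertex \<open>x0\<close> by one in
    \<open>W\<close>, and likewise provides a diametral partner of \<open>x\<close> in
    \<open>W\<close>.\<close>
  then obtain x where x: "x \<in> W" "\<And>z. z \<in> verts G \<Longrightarrow> \<delta> w z \<le> \<delta> w x"
    using cl[OF w] by (metis Max_ge finite_imageI finite_verts imageI)
  then obtain y where y: "y \<in> W" "\<delta> x y = diam G"
    using farthest_is_diam_end[of w x] cl[of x] w WV by (metis subsetD)
  have V: "x \<in> verts G" "y \<in> verts G" "w \<in> verts G" using x y w WV by auto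
  obtain b where b: "b \<in> verts G" "\<delta> x y = \<delta> x b + \<delta> b y" "\<delta> x w = \<delta> x b + \<delta> b w"
    "\<delta> y w = \<delta> y b + \<delta> b w"
    using ex_median[OF V] .
  define A1 where "A1 = {z \<in> W. \<delta> x z < Suc (\<delta> x b)}"
  define A2 where "A2 = {z \<in> W. \<delta> y z < \<delta> y b}"
  define A3 where "A3 = {z \<in> W. \<delta> w z < \<delta> w b}"
  \<comment> \<open>A sphere around \<open>u\<close> of radius at most \<open>\<delta> u t\<close>
    is nonempty in the tree, hence meets \<open>W\<close>.\<close>
  have hit: "n \<le> card {z \<in> W. \<delta> u z < n}" if "u \<in> W" "t \<in> verts G" "n \<le> Suc (\<delta> u t)" for u t n
  proof (rule le_card_if_hits_lessThan)
    fix i assume "i < n"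
    then show "\<exists>z\<in>{z \<in> W. \<delta> u z < n}. \<delta> u z = i"
      using ex_at_dist[of u t i] cl[of u] that WV by fastforce
  qed (use \<open>finite W\<close> in simp)
  have "Suc (\<delta> x b) \<le> card A1" "\<delta> y b \<le> card A2" "\<delta> w b \<le> card A3"
    unfolding A1_def A2_def A3_def using x y w V b
    by (auto intro!: hit[where t = b])
  \<comment> \<open>A common vertex would give a route between the two centres shorter than the one
    through \<open>b\<close>.\<close>
  moreover have "A1 \<inter> A2 = {}"
    using dist_triangle[of x _ y] V b WV
    by (fastforce simp: A1_def A2_def dist_commute disjoint_iff)
  moreover have "(A1 \<union> A2) \<inter> A3 = {}"
    using dist_triangle[of x _ w] dist_triangle[of y _ w] V b WV
    by (fastforce simp: A1_def A2_def A3_def dist_commute disjoint_iff)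
  moreover have "finite A1" "finite A2" "finite A3"
    using \<open>finite W\<close> by (auto simp: A1_def A2_def A3_def)
  ultimately have "Suc (\<delta> x b) + \<delta> y b + \<delta> w b \<le> card (A1 \<union> A2 \<union> A3)"
    by (simp add: card_Un_disjoint)
  also have "\<dots> \<le> card W"
    using \<open>finite W\<close> by (intro card_mono) (auto simp: A1_def A2_def A3_def)
  finally show ?thesis
    using height_le_between[of x y b w] V b y dist_commute[of b] by auto
qed

text \<open>Each step of the walk raises the distance from its start by at most one, so no value is
  skipped.\<close>

lemma vwalk_dist_intermediate:
  assumes "vwalk R G" "n \<le> \<delta> (hd R) (last R)"
  shows "\<exists>y\<in>set R. \<delta> (hd R) y = n"
  using assms
proof (induction R rule: rev_induct)
  case (snoc y R)
  show ?case
  proof (cases "R = []")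
    case True
    then show ?thesis using snoc by auto
  next
    case False
    have R: "vwalk R G" using snoc(2) False by (rule vwalkI_append_l[rotated])
    have "(last R, y) \<in> arcs_ends G"
      using snoc(2) False by (auto simp: vwalk_def set_vwalk_arcs_snoc)
    moreover have "hd R \<in> verts G" "last R \<in> verts G" "y \<in> verts G"
      using R False snoc(2) by (auto simp: vwalk_def)
    ultimately have "\<delta> (hd R) y \<le> Suc (\<delta> (hd R) (last R))"
      using dist_triangle[of "hd R" "last R" y] dist_adj by simp
    then show ?thesis
      using snoc.IH[OF R] snoc(3) False by (cases "n \<le> \<delta> (hd R) (last R)") auto
  qed
qed (auto simp: vwalk_def)

lemma ex_dist_closed:
  assumes v: "v \<in> verts G"
  shows "\<exists>S. dist_closed S \<and> v \<in> S \<and> card S \<le> diam G + height v + 1"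
proof -
  obtain u P where P: "P \<in> diam_paths G" "u \<in> set P" "height v = \<delta> u v" using ex_height .
  then have "vpath P G" "length P - 1 = diam G" by (simp_all add: diam_paths_def)
  then have PV: "vpath P G" "length P = Suc (diam G)"
    using length_pos_if_in_set[OF P(2)] by (blast, linarith)
  have u: "u \<in> verts G" using P diam_pathsD by blast
  from ex_shortest_path[OF v u] obtain Q
    where Q: "vpath Q G" "hd Q = v" "last Q = u" "length Q = Suc (\<delta> v u)" .
  have Qne: "Q \<noteq> []" and Pne: "P \<noteq> []" using Q PV by auto
  let ?S = "set P \<union> set Q"
  have "card ?S + card (set P \<inter> set Q) = card (set P) + card (set Q)"
    using card_Un_Int[of "set P" "set Q"] by simp
  moreover have "card (set P) = Suc (diam G)" "card (set Q) = Suc (\<delta> v u)"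
    using PV Q by (auto simp: vpath_def distinct_card)
  \<comment> \<open>The paths share \<open>u\<close>, which saves one vertex in the count.\<close>
  moreover have "set P \<inter> set Q \<noteq> {}" using P Q Qne by auto
  then have "0 < card (set P \<inter> set Q)" by (simp add: card_gt_0_iff)
  ultimately have "card ?S \<le> diam G + height v + 1"
    using P(3) dist_commute[OF v u] by linarith
  moreover have "v \<in> ?S" using Q Qne hd_in_set by fastforce
  \<comment> \<open>A farthest vertex is always an end of \<open>P\<close>, and a walk inside \<open>?S\<close> to that end
    passes through all smaller distances.\<close>
  moreover have "dist_closed ?S"
    unfolding dist_closed_def
  proof (intro conjI ballI)
    show SV: "?S \<subseteq> verts G" using PV Q by (auto simp: vpath_def vwalk_def)
    have along: "\<exists>R. vwalk R G \<and> hd R = x \<and> last R = t \<and> set R \<subseteq> set P"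
      if x: "x \<in> set P" and t: "t \<in> {hd P, last P}" for x t
    proof -
      obtain P1 P2 where pe: "P = P1 @ x # P2" using split_list[OF x] by blast
      have "vwalk P G" using PV by auto
      then have "vwalk (x # P2) G" "vwalk (P1 @ [x]) G"
        using vwalkI_append_r[of "x # P2" P1 G] vwalkI_append_l[of "P1 @ [x]" P2 G] pe by simp_all
      then have walks: "vwalk (x # P2) G" "vwalk (rev (P1 @ [x])) G"
        using vwalk_rev[OF sym_digraph_G] by blast+
      show ?thesis
      proof (cases "t = last P")
        case True
        then show ?thesis using walks(1) pe by (intro exI[of _ "x # P2"]) auto
      next
        case False
        then have "t = hd P" using t by blast
        then have "last (rev (P1 @ [x])) = t" using pe by (cases P1) simp_all
        then show ?thesis using walks(2) pe by (intro exI[of _ "rev (P1 @ [x])"]) auto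
      qed
    qed
    have conn: "\<exists>R. vwalk R G \<and> hd R = x \<and> last R = t \<and> set R \<subseteq> ?S"
      if x: "x \<in> ?S" and t: "t \<in> {hd P, last P}" for x t
    proof (cases "x \<in> set P")
      case True
      from along[OF this t] obtain R where "vwalk R G" "hd R = x" "last R = t" "set R \<subseteq> set P"
        by (elim exE conjE)
      then show ?thesis by (intro exI[of _ R] conjI le_supI1)
    next
      case False
      then obtain Q1 Q2 where qe: "Q = Q1 @ x # Q2" using x split_list[of x Q] by blast
      have w: "vwalk (x # Q2) G"
        using Q(1) vwalkI_append_r[of "x # Q2" Q1 G] unfolding qe vpath_def by simp
      obtain R where R: "vwalk R G" "hd R = u" "last R = t" "set R \<subseteq> set P"
        using along[OF P(2) t] by (elim exE conjE)
      then have "R \<noteq> []" by (simp add: vwalk_def)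
      have "last (x # Q2) = u" using Q(3) unfolding qe by simp
      then have j: "joinable (x # Q2) R" using \<open>R \<noteq> []\<close> R(2) by (intro joinableI) simp_all
      have "set (tl R) \<subseteq> set R" using \<open>R \<noteq> []\<close> list.set_sel(2)[of R] by blast
      then have "set (vwalk_join (x # Q2) R) \<subseteq> ?S"
        using R(4) unfolding qe vwalk_join_def by auto
      moreover have "hd (vwalk_join (x # Q2) R) = x"
        unfolding vwalk_join_hd[OF j] by (rule list.sel(1))
      moreover have "last (vwalk_join (x # Q2) R) = t"
        unfolding vwalk_join_last[OF j] by (rule R(3))
      ultimately show ?thesis
        using vwalk_joinI_vwalk[OF w R(1) j] by (intro exI[of _ "vwalk_join (x # Q2) R"] conjI)
    qed
    fix x z assume x: "x \<in> ?S" and z: "z \<in> verts G"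
    have "\<delta> (hd P) (last P) = diam G" using dist_vpath PV by simp
    moreover have "hd P \<in> verts G" "last P \<in> verts G" "x \<in> verts G" using SV Pne x by auto
    ultimately have "\<delta> x z \<le> \<delta> x (hd P) \<or> \<delta> x z \<le> \<delta> x (last P)"
      using diam_end_eccentric[of "hd P" "last P" x z] z by (simp add: le_max_iff_disj)
    then obtain t where t: "t \<in> {hd P, last P}" "\<delta> x z \<le> \<delta> x t" by blast
    obtain R where R: "vwalk R G" "hd R = x" "last R = t" "set R \<subseteq> ?S"
      using conn[OF x t(1)] by blast
    then have "\<exists>y\<in>set R. \<delta> x y = \<delta> x z"
      using vwalk_dist_intermediate[OF R(1), of "\<delta> x z"] t(2) by simp
    then show "\<exists>w\<in>?S. \<delta> x w = \<delta> x z" using R(4) by blast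
  qed
  ultimately show ?thesis by blast
qed

end

subsection \<open>The game\<close>

text \<open>
  \<open>U\<close> is the visited set, \<open>u\<close> the position of the token and \<open>n\<close> bounds the number of remaining
  turns; the distance named is represented by a vertex \<open>t\<close> realising it.
\<close>

primrec explorer_wins :: "('a,'b) pre_digraph \<Rightarrow> nat \<Rightarrow> nat \<Rightarrow> 'a set \<Rightarrow> 'a \<Rightarrow> bool" where
  "explorer_wins G k 0 U u \<longleftrightarrow> k \<le> card U"
| "explorer_wins G k (Suc n) U u \<longleftrightarrow> k \<le> card U \<or>
    (\<exists>t\<in>verts G. \<forall>w\<in>verts G. graph_dist G u w = graph_dist G u t \<longrightarrow>
      explorer_wins G k n (insert w U) w)"

lemma explorer_wins_Suc: "explorer_wins G k n U u \<Longrightarrow> explorer_wins G k (Suc n) U u"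
  by (induction n arbitrary: U u) (simp, simp only: explorer_wins.simps, blast)

lemma explorer_wins_mono:
  assumes "explorer_wins G k m U u" "m \<le> n"
  shows "explorer_wins G k n U u"
  using assms(2,1) by (induction n rule: dec_induct) (auto intro: explorer_wins_Suc simp del: explorer_wins.simps)

section \<open>Strategies from winning positions, and the Director's play inside a closed
  set\<close>

context finite_tree
begin

text \<open>The strategy always names a distance that lowers \<open>rank\<close>, the least number
  of turns sufficient to win.\<close>

lemma explorer_guarantees_if_wins:
  assumes "v \<in> verts G" "explorer_wins G k N {v} v"
  shows "explorer_guarantees G v k"
proof -
  define good where "good h n s \<longleftrightarrow>
    (\<exists>t\<in>verts G. s = \<delta> (last h) t) \<and>
    (\<forall>w\<in>verts G. \<delta> (last h) w = s \<longrightarrow> explorer_wins G k n (insert w (set h)) w)" for h n s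
  define rank where "rank h = (LEAST n. explorer_wins G k n (set h) (last h))" for h
  \<comment> \<open>The default 0 is always legal, since the token can stay where it is.\<close>
  define \<sigma> where "\<sigma> h =
    (if \<exists>n s. rank h = Suc n \<and> good h n s then SOME s. good h (rank h - 1) s else 0)" for h
  have \<sigma>_good: "good h n (\<sigma> h)" if "rank h = Suc n" "good h n s" for h n s
  proof -
    have "\<sigma> h = (SOME s. good h n s)" using that by (auto simp: \<sigma>_def)
    then show ?thesis using someI[of "good h n", OF that(2)] by simp
  qed
  have "explorer_strategy G \<sigma>"
    unfolding explorer_strategy_def
  proof (intro allI impI)
    fix h assume h: "h \<noteq> [] \<and> set h \<subseteq> verts G"
    show "\<exists>w\<in>verts G. \<delta> (last h) w = \<sigma> h"
    proof (cases "\<exists>n s. rank h = Suc n \<and> good h n s")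
      case True
      then obtain n s where "rank h = Suc n" "good h n s" by blast
      then have "good h n (\<sigma> h)" by (rule \<sigma>_good)
      then show ?thesis by (auto simp: good_def)
    next
      case False
      then have "\<sigma> h = 0" by (auto simp: \<sigma>_def)
      moreover have "last h \<in> verts G" using h last_in_set by blast
      ultimately show ?thesis by (intro bexI[of _ "last h"]) auto
    qed
  qed
  moreover have "\<exists>n. k \<le> card (x ` {0..n})" if x: "play_against G v \<sigma> x" for x
  proof (rule ccontr)
    assume no: "\<nexists>n. k \<le> card (x ` {0..n})"
    define h where "h n = map x [0..<Suc n]" for n
    have set_h: "set (h n) = x ` {0..n}" and last_h: "last (h n) = x n" for n
      by (simp_all add: h_def atLeastLessThanSuc_atLeastAtMost del: upt_Suc)
        (simp add: upt_Suc)
    have set_h_Suc: "set (h (Suc n)) = insert (x (Suc n)) (set (h n))" for n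
      by (auto simp: set_h atLeast0_atMost_Suc)
    have small: "\<not> k \<le> card (set (h n))" for n using no by (simp add: set_h)
    \<comment> \<open>Turns played and turns still needed never exceed \<open>N\<close> together,
      which is absurd at turn \<open>Suc N\<close>.\<close>
    have "\<exists>m. m + n \<le> N \<and> explorer_wins G k m (set (h n)) (x n)" for n
    proof (induction n)
      case 0
      then show ?case using assms(2) x by (auto simp: set_h play_against_def)
    next
      case (Suc n)
      then obtain m where m: "m + n \<le> N" "explorer_wins G k m (set (h n)) (last (h n))"
        by (auto simp: last_h)
      have w: "explorer_wins G k (rank (h n)) (set (h n)) (last (h n))"
        unfolding rank_def using m(2) by (rule LeastI)
      have "rank (h n) \<le> m" unfolding rank_def using m(2) by (rule Least_le)
      \<comment> \<open>Rank 0 would mean that \<open>k\<close> vertices are already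
        visited.\<close>
      obtain i where i: "rank (h n) = Suc i" using w small[of n] by (cases "rank (h n)") auto
      then obtain t where "t \<in> verts G" "\<And>w. w \<in> verts G \<Longrightarrow> \<delta> (last (h n)) w = \<delta> (last (h n)) t \<Longrightarrow>
          explorer_wins G k i (insert w (set (h n))) w"
        using w small[of n] by auto
      then have "good (h n) i (\<delta> (last (h n)) t)" by (auto simp: good_def)
      from \<sigma>_good[OF i this] have "good (h n) i (\<sigma> (h n))" .
      moreover have "x (Suc n) \<in> verts G" "\<delta> (last (h n)) (x (Suc n)) = \<sigma> (h n)"
        using x by (auto simp: play_against_def last_h) (simp add: h_def)
      ultimately have "explorer_wins G k i (set (h (Suc n))) (x (Suc n))"
        by (auto simp: good_def set_h_Suc)
      then show ?case using i \<open>rank (h n) \<le> m\<close> m(1) by (intro exI[of _ i]) simp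
    qed
    from this[of "Suc N"] show False by auto
  qed
  ultimately show ?thesis unfolding explorer_guarantees_def by blast
qed

text \<open>The Director answers every distance inside \<open>S\<close>. Since
  \<open>\<sigma>\<close> depends on the whole history, the play is built by extending
  histories.\<close>

lemma explorer_guarantees_le:
  assumes S: "dist_closed S" "v \<in> S" and k: "explorer_guarantees G v k"
  shows "k \<le> card S"
proof -
  obtain \<sigma> where \<sigma>: "explorer_strategy G \<sigma>"
    "\<And>x. play_against G v \<sigma> x \<Longrightarrow> \<exists>n. k \<le> card (x ` {0..n})"
    using k by (auto simp: explorer_guarantees_def)
  have SV: "S \<subseteq> verts G" and cl: "\<And>u z. u \<in> S \<Longrightarrow> z \<in> verts G \<Longrightarrow> \<exists>w\<in>S. \<delta> u w = \<delta> u z"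
    using S by (auto simp: dist_closed_def)
  define move where "move h = (SOME w. w \<in> S \<and> \<delta> (last h) w = \<sigma> h)" for h
  define hist where "hist n = ((\<lambda>h. h @ [move h]) ^^ n) [v]" for n
  have hist_0: "hist 0 = [v]" and hist_Suc: "hist (Suc n) = hist n @ [move (hist n)]" for n
    by (simp_all add: hist_def)
  define x where "x n = last (hist n)" for n
  have move: "move h \<in> S \<and> \<delta> (last h) (move h) = \<sigma> h" if h: "h \<noteq> []" "set h \<subseteq> S" for h
  proof -
    have "last h \<in> S" using h last_in_set by blast
    moreover obtain z where "z \<in> verts G" "\<delta> (last h) z = \<sigma> h"
      using \<sigma>(1) h SV unfolding explorer_strategy_def by blast
    ultimately obtain w where "w \<in> S \<and> \<delta> (last h) w = \<sigma> h" using cl by metis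
    then show ?thesis unfolding move_def by (rule someI)
  qed
  have hist: "hist n \<noteq> [] \<and> set (hist n) \<subseteq> S" for n
  proof (induction n)
    case (Suc n)
    then show ?case using move[of "hist n"] by (simp add: hist_Suc)
  qed (simp add: hist_0 S(2))
  have hist_eq: "hist n = map x [0..<Suc n]" for n
    by (induction n) (auto simp: hist_0 hist_Suc x_def)
  have xS: "x n \<in> S" for n using hist[of n] by (auto simp: x_def)
  have "play_against G v \<sigma> x"
    unfolding play_against_def
  proof (intro conjI allI)
    show "x 0 = v" by (simp add: x_def hist_0)
    fix n
    show "x (Suc n) \<in> verts G" using xS SV by blast
    have "\<delta> (x n) (x (Suc n)) = \<sigma> (hist n)"
      using move[of "hist n"] hist[of n] by (simp add: x_def hist_Suc)
    then show "\<delta> (x n) (x (Suc n)) = \<sigma> (map x [0..<Suc n])" by (simp only: hist_eq)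
  qed
  then obtain n where "k \<le> card (x ` {0..n})" using \<sigma>(2) by blast
  also have "\<dots> \<le> card S"
    using xS SV finite_verts finite_subset by (intro card_mono) blast+
  finally show ?thesis .
qed

section \<open>The Explorer's lower bound\<close>

definition wins :: "nat \<Rightarrow> 'a set \<Rightarrow> 'a \<Rightarrow> bool" where
  "wins k U u \<longleftrightarrow> (\<exists>n. explorer_wins G k n U u)"

lemma wins_if_card: "k \<le> card U \<Longrightarrow> wins k U u"
  unfolding wins_def by (intro exI[of _ 0]) simp

text \<open>There are finitely many replies: if all were won, the maximum of their turn bounds would
  serve them all, and the position itself would be won.\<close>

lemma not_winsE:
  assumes "\<not> wins k U u" "t \<in> verts G"
  obtains w where "w \<in> verts G" "\<delta> u w = \<delta> u t" "\<not> wins k (insert w U) w"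
proof (rule ccontr)
  assume "\<not> thesis"
  then have "\<And>w. w \<in> verts G \<Longrightarrow> \<delta> u w = \<delta> u t \<Longrightarrow> \<exists>n. explorer_wins G k n (insert w U) w"
    using that by (auto simp: wins_def)
  then obtain n where n: "\<And>w. w \<in> verts G \<Longrightarrow> \<delta> u w = \<delta> u t \<Longrightarrow> explorer_wins G k (n w) (insert w U) w"
    by metis
  have "explorer_wins G k (Max (n ` verts G)) (insert w U) w" if "w \<in> verts G" "\<delta> u w = \<delta> u t" for w
    using n[OF that] that by (rule_tac explorer_wins_mono) auto
  then have "explorer_wins G k (Suc (Max (n ` verts G))) U u" using assms(2) by auto
  then show False using assms(1) by (auto simp: wins_def simp del: explorer_wins.simps)
qed

text \<open>
  The invariant of the opening phase, in which the Explorer collects \<open>l\<close> vertices away from the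
  diametral paths: it holds initially for \<open>j = l\<close>, and the aim is \<open>j = 1\<close>. The counts by height
  matter because the closed set in which the game ends may reuse the low vertices.
\<close>

definition spread :: "nat \<Rightarrow> nat \<Rightarrow> 'a set \<Rightarrow> bool" where
  "spread l j U \<longleftrightarrow> (\<forall>i. j \<le> i \<and> i \<le> l \<longrightarrow> Suc l \<le> i + card {u \<in> U. i \<le> height u})"

lemma card_insert_filter_mono:
  assumes "U \<subseteq> verts G"
  shows "card {u \<in> U. P u} \<le> card {u \<in> insert w U. P u}"
  using assms finite_subset[OF _ finite_verts] by (intro card_mono) auto

lemma spread_insert:
  assumes "spread l j U" "U \<subseteq> verts G"
  shows "spread l j (insert w U)"
  using assms card_insert_filter_mono[OF assms(2)] unfolding spread_def
  by (meson add_le_mono le_refl le_trans)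

text \<open>Induction on the number of unvisited vertices. If the Explorer cannot win, the
  Director's safe visited vertices form a closed set, and \<open>spread\<close> supplies enough
  further visited vertices above it.\<close>

lemma wins_if_spread:
  assumes "spread l 1 U" "U \<subseteq> verts G" "u \<in> U"
  shows "wins (diam G + l + 1) U u"
  using assms
proof (induction "card (verts G) - card U" arbitrary: U u rule: less_induct)
  case less
  let ?k = "diam G + l + 1"
  have fin: "finite U" using less.prems finite_verts finite_subset by blast
  define W where "W = {u \<in> U. \<not> wins ?k U u}"
  have "dist_closed W"
    unfolding dist_closed_def
  proof (intro conjI ballI)
    show "W \<subseteq> verts G" using less.prems by (auto simp: W_def)
    fix u z assume u: "u \<in> W" and z: "z \<in> verts G"
    then have "\<not> wins ?k U u" by (simp add: W_def)
    then obtain w where w: "w \<in> verts G" "\<delta> u w = \<delta> u z" "\<not> wins ?k (insert w U) w"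
      using z by (rule not_winsE)
    \<comment> \<open>A new vertex would keep \<open>spread\<close> and leave fewer unvisited ones,
      so the Explorer would win from it.\<close>
    have "w \<in> U"
    proof (rule ccontr)
      assume "w \<notin> U"
      then have "card U < card (verts G)" using w(1) less.prems(2)
        by (intro psubset_card_mono) auto
      then have "wins ?k (insert w U) w"
        using w(1) less.prems fin \<open>w \<notin> U\<close>
        by (intro less.hyps spread_insert) auto
      then show False using w by simp
    qed
    then show "\<exists>w\<in>W. \<delta> u w = \<delta> u z" using w by (auto simp: W_def insert_absorb)
  qed
  show ?case
  proof (rule ccontr)
    assume "\<not> wins ?k U u"
    then have "W \<noteq> {}" using less.prems by (auto simp: W_def)
    have "finite W" using fin by (simp add: W_def)
    define t where "t = Max (height ` W)"
    have "t \<in> height ` W" unfolding t_def using \<open>W \<noteq> {}\<close> \<open>finite W\<close> by (intro Max_in) auto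
    then obtain w where w: "w \<in> W" "height w = t" by auto
    have max: "height w \<le> t" if "w \<in> W" for w using that \<open>finite W\<close> by (simp add: t_def)
    let ?H = "{u \<in> U. Suc t \<le> height u}"
    \<comment> \<open>This is \<open>spread\<close> at \<open>Suc t\<close>, an index at least 1;
      for \<open>t\<close> at least \<open>l\<close> the bound is trivial.\<close>
    have "l \<le> t + card ?H"
      using less.prems(1) by (cases "Suc t \<le> l") (auto simp: spread_def)
    moreover have "diam G + t + 1 \<le> card W" using card_dist_closed[OF \<open>dist_closed W\<close> w(1)] w(2) by simp
    moreover have "card W + card ?H = card (W \<union> ?H)"
      using \<open>finite W\<close> fin max by (intro card_Un_disjoint[symmetric]) fastforce+
    moreover have "card (W \<union> ?H) \<le> card U" using fin by (intro card_mono) (auto simp: W_def)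
    ultimately have "?k \<le> card U" by simp
    then show False using wins_if_card \<open>\<not> wins ?k U u\<close> by blast
  qed
qed

lemma ex_dist_eq_height:
  assumes "u \<in> verts G"
  shows "\<exists>z\<in>verts G. height u = \<delta> u z"
proof -
  obtain z P where z: "P \<in> diam_paths G" "z \<in> set P" "height u = \<delta> z u" using ex_height .
  then have "z \<in> verts G" using diam_pathsD by blast
  then show ?thesis using z dist_commute assms by auto
qed

text \<open>
  From height \<open>h\<close> the Explorer only names distances up to \<open>h - j\<close>, so the token never drops below
  height \<open>j\<close>. If no new vertex could be forced, the token would stay in a set \<open>W\<close> of visited
  vertices with maximal height \<open>t\<close>; this set has more than \<open>t - j\<close> elements, and together with
  the visited vertices above height \<open>t\<close> they already establish the invariant for \<open>j\<close>.
\<close>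

lemma wins_if_spread_above:
  assumes "spread l j U" "1 \<le> j" "U \<subseteq> verts G" "u \<in> U" "j \<le> height u"
  shows "wins (diam G + l + 1) U u"
  using assms(2,1,3-5)
proof (induction j arbitrary: U u rule: dec_induct)
  case base
  then show ?case using wins_if_spread by blast
next
  case (step j)
  let ?k = "diam G + l + 1"
  have fin: "finite U" using step.prems finite_verts finite_subset by blast
  show ?case
  proof (rule ccontr)
    assume nw: "\<not> wins ?k U u"
    have not_spread: "\<not> spread l j U"
      using step.IH[of U u] step.prems nw by auto
    \<comment> \<open>The counts are known from \<open>Suc j\<close> on, so \<open>spread\<close>
      can fail only at \<open>j\<close>.\<close>
    then have j: "j \<le> l" and few: "j + card {u \<in> U. j \<le> height u} \<le> l"
      using step.prems(1) unfolding spread_def by (metis Suc_leI le_neq_implies_less not_less_eq_eq le_trans)+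
    define W where "W = {u \<in> U. \<not> wins ?k U u \<and> Suc j \<le> height u}"
    have W: "finite W" "W \<noteq> {}" "W \<subseteq> U" using fin nw step.prems by (auto simp: W_def)
    have cl: "\<exists>w\<in>W. \<delta> u w = n" if u: "u \<in> W" and n: "n \<le> height u - j" for u n
    proof -
      have uV: "u \<in> verts G" using u W step.prems by blast
      obtain z where z: "z \<in> verts G" "\<delta> u z = n"
        using ex_dist_eq_height[OF uV] ex_at_dist[OF uV, of _ n] n by (metis diff_le_self le_trans)
      have "\<not> wins ?k U u" using u by (simp add: W_def)
      then obtain w where w: "w \<in> verts G" "\<delta> u w = \<delta> u z" "\<not> wins ?k (insert w U) w"
        using z(1) by (rule not_winsE)
      have hw: "j \<le> height w"
        using height_triangle[OF uV w(1)] w(2) z(2) n u by (auto simp: W_def)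
      have "w \<in> U"
      proof (rule ccontr)
        assume "w \<notin> U"
        \<comment> \<open>Being new and of height at least \<open>j\<close>, \<open>w\<close>
          supplies the one vertex missing in the count at \<open>j\<close>.\<close>
        have "spread l j (insert w U)"
          unfolding spread_def
        proof (intro allI impI)
          fix i assume i: "j \<le> i \<and> i \<le> l"
          show "Suc l \<le> i + card {u \<in> insert w U. i \<le> height u}"
          proof (cases "i = j")
            case True
            have "{u \<in> insert w U. j \<le> height u} = insert w {u \<in> U. j \<le> height u}" using hw by auto
            then have "card {u \<in> insert w U. j \<le> height u} = Suc (card {u \<in> U. j \<le> height u})"
              using fin \<open>w \<notin> U\<close> by simp
            moreover have "l \<le> j + card {u \<in> U. j \<le> height u}"
            proof (cases "Suc j \<le> l")
              case True
              have "card {u \<in> U. Suc j \<le> height u} \<le> card {u \<in> U. j \<le> height u}"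
                using fin by (intro card_mono) auto
              then show ?thesis using step.prems(1) True by (fastforce simp: spread_def)
            qed (use j in simp)
            ultimately show ?thesis using True by simp
          next
            case False
            then show ?thesis
              using spread_insert[OF step.prems(1,2)] i by (auto simp: spread_def)
          qed
        qed
        then show False using step.IH[of "insert w U" w] w hw step.prems by auto
      qed
      \<comment> \<open>A visited vertex of height exactly \<open>j\<close>, on top of those counted
        at \<open>Suc j\<close>, would already complete the count at \<open>j\<close>.\<close>
      have "height w \<noteq> j"
      proof
        assume "height w = j"
        have "insert w {u \<in> U. Suc j \<le> height u} \<subseteq> {u \<in> U. j \<le> height u}"
          using \<open>w \<in> U\<close> \<open>height w = j\<close> by auto
        from card_mono[OF _ this] have "Suc (card {u \<in> U. Suc j \<le> height u}) \<le> card {u \<in> U. j \<le> height u}"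
          using fin \<open>height w = j\<close> by simp
        moreover have "l \<le> j + card {u \<in> U. Suc j \<le> height u}"
          using step.prems(1) by (cases "Suc j \<le> l") (auto simp: spread_def)
        ultimately show False using few by simp
      qed
      then have "w \<in> W" using w hw \<open>w \<in> U\<close> by (auto simp: W_def insert_absorb)
      then show ?thesis using w z by blast
    qed
    define t where "t = Max (height ` W)"
    have "t \<in> height ` W" unfolding t_def using W by (intro Max_in) auto
    then obtain w where w: "w \<in> W" "height w = t" by auto
    have max: "height w \<le> t" if "w \<in> W" for w using that W by (simp add: t_def)
    \<comment> \<open>All distances from 0 to \<open>t - j\<close> are realised from
      \<open>w\<close> inside \<open>W\<close>. With the visited vertices above height
      \<open>t\<close> this gives more than \<open>l - j\<close> of height at least
      \<open>j\<close>, against \<open>few\<close>.\<close>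
    have "Suc (t - j) \<le> card W"
      using W(1) by (rule le_card_if_hits_lessThan[where f = "\<delta> w"]) (use cl[OF w(1)] w(2) in auto)
    moreover have "j < t" using w by (auto simp: W_def)
    moreover have "l \<le> t + card {u \<in> U. Suc t \<le> height u}"
      using step.prems(1)[unfolded spread_def, rule_format, of "Suc t"] \<open>j < t\<close>
      by (cases "Suc t \<le> l") auto
    moreover have "card W + card {u \<in> U. Suc t \<le> height u} = card (W \<union> {u \<in> U. Suc t \<le> height u})"
      using W fin max by (intro card_Un_disjoint[symmetric]) fastforce+
    moreover have "card (W \<union> {u \<in> U. Suc t \<le> height u}) \<le> card {u \<in> U. j \<le> height u}"
      using fin \<open>j < t\<close> by (intro card_mono) (auto simp: W_def)
    ultimately show False using few by simp
  qed
qed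

lemma wins_start:
  assumes "v \<in> verts G"
  shows "wins (diam G + height v + 1) {v} v"
proof (cases "height v = 0")
  case True
  \<comment> \<open>At height 0 the invariant is vacuous.\<close>
  then show ?thesis using assms by (intro wins_if_spread) (auto simp: spread_def)
next
  case False
  have "{u. u = v \<and> height v \<le> height u} = {v}" by auto
  \<comment> \<open>Only \<open>i = height v\<close> is in range, and \<open>v\<close> itself is the
    one vertex required there.\<close>
  then have "spread (height v) (height v) {v}" by (auto simp: spread_def)
  then show ?thesis using False assms by (intro wins_if_spread_above) auto
qed

theorem f_d_eq:
  assumes "v \<in> verts G"
  shows "f_d G v = diam G + height v + 1"
proof -
  let ?k = "diam G + height v + 1"
  obtain S where S: "dist_closed S" "v \<in> S" "card S \<le> ?k"
    using ex_dist_closed[OF assms] by blast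
  have "explorer_guarantees G v ?k"
    using wins_start[OF assms] explorer_guarantees_if_wins[OF assms] by (auto simp: wins_def)
  moreover have "k \<le> ?k" if "explorer_guarantees G v k" for k
    using explorer_guarantees_le[OF S(1,2) that] S(3) by simp
  \<comment> \<open>The upper bound also makes the set finite, so \<open>Max\<close> is its greatest
    element.\<close>
  moreover from this have "finite {k. explorer_guarantees G v k}"
    by (intro finite_subset[OF _ finite_atMost[of ?k]]) auto
  ultimately show ?thesis unfolding f_d_def by (intro Max_eqI) auto
qed

end

theorem theorem3p4:
  fixes G :: "('a,'b) pre_digraph" and v :: 'a and l :: nat
  assumes "finite_tree G"
    and "v \<in> verts G"
    and "l = Min {graph_dist G u v | u P. P \<in> diam_paths G \<and> u \<in> set P}"
  shows "f_d G v = diam G + l + 1"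
  using finite_tree.f_d_eq[OF assms(1,2)] assms(3) finite_tree.height_def[OF assms(1)] by simp

end
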